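(* A connected graph $G$ with no isolated vertices is $\gamma_{tR}$-ER-supercritical if and only if $G$ is either a non-trivial star $K_{1,n}$ ($n\geq 1$), or a double star in which each of the two non-pendant vertices has degree at least $3$.
   Context: All graphs are finite and simple. A double star is a tree obtained from two disjoint non-trivial stars by joining their central vertices by an edge (choosing either vertex as centre in the case of $K_2$). A total Roman dominating function (TRD-function) on a graph $G$ with no isolated vertices is a function $f:V(G)\to\{0,1,2\}$ such that every vertex $v$ with $f(v)=0$ is adjacent to some $u$ with $f(u)=2$, and the subgraph induced by $\{w:f(w)>0\}$ has no isolated vertices; its weight is $\sum_v f(v)$ and $\gamma_{tR}(G)$ is the minimum weight. For an edge $e$ incident with a vertex of degree $1$, define $\gamma_{tR}(G-e)=\infty$. A graph $G$ with no isolated vertices is $\gamma_{tR}$-ER-supercritical if $\gamma_{tR}(G-e)\geq\gamma_{tR}(G)+2$ for every edge $e\in E(G)$. *)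

theory Defs
  imports Main "HOL-Library.FuncSet" "HOL-Library.Extended_Nat"
begin

definition simple_graph :: "'a set \<Rightarrow> 'a set set \<Rightarrow> bool" where
  "simple_graph V E \<longleftrightarrow> finite V \<and> (\<forall>e\<in>E. e \<subseteq> V \<and> card e = 2)"

definition degree :: "'a set set \<Rightarrow> 'a \<Rightarrow> nat" where
  "degree E v = card {e \<in> E. v \<in> e}"

definition isolated_free :: "'a set \<Rightarrow> 'a set set \<Rightarrow> bool" where
  "isolated_free V E \<longleftrightarrow> (\<forall>v\<in>V. \<exists>u\<in>V. {u, v} \<in> E)"

definition induced_edges :: "'a set set \<Rightarrow> 'a set \<Rightarrow> 'a set set" where
  "induced_edges E W = {e \<in> E. e \<subseteq> W}"

text \<open>The empty graph does not count as connected.\<close>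

definition connected_graph :: "'a set \<Rightarrow> 'a set set \<Rightarrow> bool" where
  "connected_graph V E \<longleftrightarrow>
     V \<noteq> {} \<and> (\<forall>u\<in>V. \<forall>v\<in>V. (u, v) \<in> {(x, y). {x, y} \<in> E}\<^sup>*)"

definition TRD_function :: "'a set \<Rightarrow> 'a set set \<Rightarrow> ('a \<Rightarrow> nat) \<Rightarrow> bool" where
  "TRD_function V E f \<longleftrightarrow>
     f \<in> V \<rightarrow> {0, 1, 2} \<and>
     (\<forall>v\<in>V. f v = 0 \<longrightarrow> (\<exists>u\<in>V. {u, v} \<in> E \<and> f u = 2)) \<and>
     isolated_free {w \<in> V. f w > 0} (induced_edges E {w \<in> V. f w > 0})"

text \<open>Meaningful only for graphs without isolated vertices: otherwise no total Roman
  dominating function exists and the value of \<^const>\<open>Least\<close> is unspecified.\<close>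

definition gamma_tR :: "'a set \<Rightarrow> 'a set set \<Rightarrow> nat" where
  "gamma_tR V E = (LEAST k. \<exists>f. TRD_function V E f \<and> (\<Sum>v\<in>V. f v) = k)"

definition gamma_tR_remove :: "'a set \<Rightarrow> 'a set set \<Rightarrow> 'a set \<Rightarrow> enat" where
  "gamma_tR_remove V E e =
     (if \<exists>v\<in>e. degree E v = 1 then \<infinity> else enat (gamma_tR V (E - {e})))"

definition ER_supercritical :: "'a set \<Rightarrow> 'a set set \<Rightarrow> bool" where
  "ER_supercritical V E \<longleftrightarrow>
     isolated_free V E \<and> (\<forall>e\<in>E. gamma_tR_remove V E e \<ge> enat (gamma_tR V E) + 2)"

text \<open>The graph is a copy of $K_{1,n}$ with centre \<open>c\<close>. For $n = 1$ both vertices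
  qualify as centre.\<close>

definition star_centred :: "'a \<Rightarrow> nat \<Rightarrow> 'a set \<Rightarrow> 'a set set \<Rightarrow> bool" where
  "star_centred c n V E \<longleftrightarrow>
     finite V \<and> c \<in> V \<and> card (V - {c}) = n \<and> E = {{c, x} | x. x \<in> V - {c}}"

definition is_star :: "nat \<Rightarrow> 'a set \<Rightarrow> 'a set set \<Rightarrow> bool" where
  "is_star n V E \<longleftrightarrow> (\<exists>c. star_centred c n V E)"

definition double_star :: "'a set \<Rightarrow> 'a set set \<Rightarrow> bool" where
  "double_star V E \<longleftrightarrow>
     (\<exists>c\<^sub>1 n\<^sub>1 V\<^sub>1 E\<^sub>1 c\<^sub>2 n\<^sub>2 V\<^sub>2 E\<^sub>2.
        n\<^sub>1 \<ge> 1 \<and> star_centred c\<^sub>1 n\<^sub>1 V\<^sub>1 E\<^sub>1 \<and>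
        n\<^sub>2 \<ge> 1 \<and> star_centred c\<^sub>2 n\<^sub>2 V\<^sub>2 E\<^sub>2 \<and>
        V\<^sub>1 \<inter> V\<^sub>2 = {} \<and> V = V\<^sub>1 \<union> V\<^sub>2 \<and> E = E\<^sub>1 \<union> E\<^sub>2 \<union> {{c\<^sub>1, c\<^sub>2}})"

end

theory Submission
  imports Defs
begin

text \<open>Let \<open>f\<close> be a minimum TRD-function of a supercritical graph. If \<open>uv\<close> is an edge neither end
  of which is a leaf, then no function of weight at most one more than that of \<open>f\<close> is a
  TRD-function of \<open>G - uv\<close>. Raising \<open>f\<close> from 0 to 1 at a single suitable vertex shows that this
  forces \<open>f\<close> to be positive at \<open>u\<close> and \<open>v\<close> and zero at all their other neighbours. Consequently
  every zero of \<open>f\<close> is a leaf, so by connectedness \<open>G\<close> consists of \<open>u\<close>, \<open>v\<close> and leaves attached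
  to them. If \<open>u\<close> had degree 2, then \<open>f u = 2\<close> could be split into 1 at \<open>u\<close> and 1 at its leaf,
  which yields a minimum TRD-function violating the above. Conversely, removing the central edge
  of a double star leaves two stars with at least two leaves, each of total Roman
  domination number 3.\<close>

section \<open>TRD-functions and their minimum weight\<close>

text \<open>Flattening the induced subgraph into "every positive vertex has a positive neighbour"
  lets changes of \<open>f\<close> or of the edge set be checked vertex by vertex.\<close>

lemma TRD_function_iff:
  "TRD_function V E f \<longleftrightarrow>
     (\<forall>v\<in>V. f v \<in> {0, 1, 2}) \<and>
     (\<forall>v\<in>V. f v = 0 \<longrightarrow> (\<exists>u\<in>V. {u, v} \<in> E \<and> f u = 2)) \<and>
     (\<forall>v\<in>V. f v > 0 \<longrightarrow> (\<exists>u\<in>V. {u, v} \<in> E \<and> f u > 0))"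
  unfolding TRD_function_def isolated_free_def induced_edges_def Pi_def by auto

lemma TRD_function_zeroD:
  "TRD_function V E f \<Longrightarrow> v \<in> V \<Longrightarrow> f v = 0 \<Longrightarrow> \<exists>u\<in>V. {u, v} \<in> E \<and> f u = 2"
  by (simp add: TRD_function_iff)

lemma TRD_function_posD:
  "TRD_function V E f \<Longrightarrow> v \<in> V \<Longrightarrow> f v > 0 \<Longrightarrow> \<exists>u\<in>V. {u, v} \<in> E \<and> f u > 0"
  by (simp add: TRD_function_iff)

lemma gamma_tR_le: "TRD_function V E f \<Longrightarrow> gamma_tR V E \<le> sum f V"
  unfolding gamma_tR_def by (rule Least_le) auto

text \<open>Without isolated vertices the constant function 1 is a TRD-function, so
  \<open>LEAST\<close> ranges over a nonempty set.\<close>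

lemma gamma_tR_attained:
  assumes "isolated_free V E"
  obtains f where "TRD_function V E f" "sum f V = gamma_tR V E"
proof -
  have "TRD_function V E (\<lambda>_. 1)"
    using assms by (auto simp: TRD_function_iff isolated_free_def)
  then have "\<exists>k f. TRD_function V E f \<and> sum f V = k" by blast
  then have "\<exists>f. TRD_function V E f \<and> sum f V = gamma_tR V E"
    unfolding gamma_tR_def by (rule LeastI_ex)
  then show thesis using that by blast
qed

section \<open>Neighbours and degrees in finite simple graphs\<close>

lemma degree_one_unique_neighbour:
  assumes "degree E v = 1" "{v, x} \<in> E" "{v, y} \<in> E"
  shows "x = y"
proof -
  obtain e where e: "{e \<in> E. v \<in> e} = {e}"
    using assms(1) unfolding degree_def by (rule card_1_singletonE)
  have "{v, x} \<in> {e \<in> E. v \<in> e}" "{v, y} \<in> {e \<in> E. v \<in> e}" using assms(2,3) by simp_all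
  then have "{v, x} = e" "{v, y} = e" unfolding e by simp_all
  then show ?thesis by (metis doubleton_eq_iff)
qed

locale fin_simple_graph =
  fixes V :: "'a set" and E :: "'a set set"
  assumes simple: "simple_graph V E"
begin

lemma finite_V: "finite V"
  using simple by (simp add: simple_graph_def)

lemma finite_E: "finite E"
  using simple unfolding simple_graph_def
  by (meson finite_Pow_iff finite_subset PowI subsetI)

lemma edgeD:
  assumes "{x, y} \<in> E"
  shows "x \<in> V" "y \<in> V" "x \<noteq> y"
  using assms simple unfolding simple_graph_def by fastforce+

lemma edge_pairE:
  assumes "e \<in> E"
  obtains x y where "e = {x, y}"
  using assms simple unfolding simple_graph_def by (meson card_2_iff)

lemma second_neighbour:
  assumes "{v, x} \<in> E" "degree E v \<noteq> 1"
  obtains y where "{v, y} \<in> E" "y \<noteq> x"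
proof -
  have "\<exists>y. {v, y} \<in> E \<and> y \<noteq> x"
  proof (rule ccontr)
    assume no: "\<not> ?thesis"
    have "e = {v, x}" if e: "e \<in> E" "v \<in> e" for e
    proof -
      obtain a b where "e = {a, b}" using e(1) by (rule edge_pairE)
      with e(2) obtain y where y: "e = {v, y}" by (auto simp: insert_commute)
      then have "y = x" using e(1) no by blast
      then show ?thesis using y by simp
    qed
    then have "{e \<in> E. v \<in> e} = {{v, x}}" using assms(1) by blast
    then show False using assms(2) by (simp add: degree_def)
  qed
  then show thesis using that by blast
qed

lemma degree_ge_3I:
  assumes "{v, x} \<in> E" "{v, y} \<in> E" "{v, z} \<in> E" "x \<noteq> y" "x \<noteq> z" "y \<noteq> z"
  shows "degree E v \<ge> 3"
proof -
  have "card {{v, x}, {v, y}, {v, z}} = 3"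
    using assms by (auto simp: doubleton_eq_iff)
  moreover have "card {{v, x}, {v, y}, {v, z}} \<le> card {e \<in> E. v \<in> e}"
    by (rule card_mono) (use assms finite_E in auto)
  ultimately show ?thesis by (simp add: degree_def)
qed

lemma degree_one_if_unique:
  assumes "{v, x} \<in> E" "\<And>y. {v, y} \<in> E \<Longrightarrow> y = x"
  shows "degree E v = 1"
  using assms(2) second_neighbour[OF assms(1)] by blast

text \<open>Induction along a walk from \<open>c\<close>. It serves to show that a list of vertices
  found so far exhausts \<open>V\<close>.\<close>

lemma connected_closed_subset:
  assumes "connected_graph V E" "c \<in> S" "c \<in> V"
    and closed: "\<And>x y. x \<in> S \<Longrightarrow> {x, y} \<in> E \<Longrightarrow> y \<in> S"
  shows "V \<subseteq> S"
proof
  fix v assume "v \<in> V"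
  then have "(c, v) \<in> {(x, y). {x, y} \<in> E}\<^sup>*"
    using assms(1,3) by (simp add: connected_graph_def)
  then show "v \<in> S"
    by (induction rule: rtrancl_induct) (use assms(2) closed in auto)
qed

section \<open>Raising a zero to one\<close>

text \<open>The \<open>max\<close> lifts a zero at \<open>w\<close> to 1 and never destroys a 2, so
  \<open>w\<close> itself no longer needs a neighbour of value 2, only a positive one.
  \<open>F\<close> stands for the edge set after a removal.\<close>

lemma TRD_function_raise:
  assumes f: "TRD_function V E f"
    and keep: "\<And>x. x \<in> V \<Longrightarrow> f x = 0 \<Longrightarrow> x \<noteq> w \<Longrightarrow> \<exists>y\<in>V. {y, x} \<in> F \<and> f y = 2"
    and tot: "\<And>x. x \<in> V \<Longrightarrow> f x > 0 \<or> x = w \<Longrightarrow> \<exists>y\<in>V. {y, x} \<in> F \<and> (f y > 0 \<or> y = w)"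
  shows "TRD_function V F (f(w := max 1 (f w)))"
  unfolding TRD_function_iff
proof (intro conjI ballI impI)
  fix x assume x: "x \<in> V"
  show "(f(w := max 1 (f w))) x \<in> {0, 1, 2}"
    using f x by (auto simp: TRD_function_iff)
  show "\<exists>y\<in>V. {y, x} \<in> F \<and> (f(w := max 1 (f w))) y = 2" if "(f(w := max 1 (f w))) x = 0"
    using keep[OF x] that by (fastforce split: if_splits)
  show "\<exists>y\<in>V. {y, x} \<in> F \<and> 0 < (f(w := max 1 (f w))) y" if "0 < (f(w := max 1 (f w))) x"
    using tot[OF x] that by (fastforce split: if_splits)
qed

lemma sum_raise_le:
  fixes f :: "'a \<Rightarrow> nat"
  shows "sum (f(w := max 1 (f w))) V \<le> sum f V + 1"
proof (cases "w \<in> V")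
  case True
  then show ?thesis
    using finite_V by (simp add: sum.remove[where x = w])
next
  case False
  then have "sum (f(w := max 1 (f w))) V = sum f V"
    by (intro sum.cong) auto
  then show ?thesis by simp
qed

end

section \<open>Minimum TRD-functions of a supercritical graph\<close>

locale supercritical_graph = fin_simple_graph +
  assumes supercritical: "ER_supercritical V E"
begin

text \<open>Neither end is a leaf, so \<open>gamma_tR_remove\<close> is finite and the bound
  descends from \<open>enat\<close> to \<open>nat\<close>. Contradictions arise by exhibiting a
  \<open>g\<close> of weight at most one above the minimum.\<close>

lemma removed_weight:
  assumes "{u, v} \<in> E" "degree E u \<noteq> 1" "degree E v \<noteq> 1"
    and "TRD_function V (E - {{u, v}}) g"
  shows "sum g V \<ge> gamma_tR V E + 2"
proof -
  have "enat (gamma_tR V E) + 2 \<le> enat (gamma_tR V (E - {{u, v}}))"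
    using supercritical assms(1-3) unfolding ER_supercritical_def gamma_tR_remove_def
    by fastforce
  then have "gamma_tR V E + 2 \<le> gamma_tR V (E - {{u, v}})"
    by (simp add: numeral_eq_enat)
  then show ?thesis using gamma_tR_le[OF assms(4)] by linarith
qed

context
  fixes f
  assumes f: "TRD_function V E f" and minimum: "sum f V = gamma_tR V E"
begin

text \<open>Otherwise \<open>uv\<close> neither supplies a 2 to a zero nor joins two positive
  vertices, so \<open>f\<close> survives its removal unchanged.\<close>

lemma zero_end_dominated:
  assumes e: "{u, v} \<in> E" "degree E u \<noteq> 1" "degree E v \<noteq> 1" and "f v = 0"
  shows "f u = 2"
proof (rule ccontr)
  assume "f u \<noteq> 2"
  have "TRD_function V (E - {{u, v}}) f"
    unfolding TRD_function_iff
  proof (intro conjI ballI impI)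
    fix x assume x: "x \<in> V"
    show "f x \<in> {0, 1, 2}" using f x by (simp add: TRD_function_iff)
    show "\<exists>y\<in>V. {y, x} \<in> E - {{u, v}} \<and> f y = 2" if h: "f x = 0"
    proof -
      obtain y where y: "y \<in> V" "{y, x} \<in> E" "f y = 2"
        using f x h by (blast dest: TRD_function_zeroD TRD_function_posD)
      then have "{y, x} \<noteq> {u, v}"
        using \<open>f u \<noteq> 2\<close> \<open>f v = 0\<close> by (auto simp: doubleton_eq_iff)
      then show ?thesis using y by auto
    qed
    show "\<exists>y\<in>V. {y, x} \<in> E - {{u, v}} \<and> f y > 0" if h: "f x > 0"
    proof -
      obtain y where y: "y \<in> V" "{y, x} \<in> E" "f y > 0"
        using f x h by (blast dest: TRD_function_zeroD TRD_function_posD)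
      then have "{y, x} \<noteq> {u, v}"
        using h \<open>f v = 0\<close> by (auto simp: doubleton_eq_iff)
      then show ?thesis using y by auto
    qed
  qed
  from removed_weight[OF e this] minimum show False by simp
qed

text \<open>Suppose \<open>f v = 0\<close>, so \<open>f u = 2\<close>, and let \<open>w\<close> be
  another neighbour of \<open>v\<close>. If \<open>w\<close> is positive, raising \<open>v\<close>
  to 1 makes \<open>uv\<close> dispensable. If \<open>w\<close> is zero, it is no leaf, being
  adjacent to a vertex of value 2 besides \<open>v\<close>; then \<open>vw\<close> joins two zeros,
  against \<open>zero_end_dominated\<close>.\<close>

lemma inner_edge_end_positive:
  assumes e: "{u, v} \<in> E" "degree E u \<noteq> 1" "degree E v \<noteq> 1"
  shows "f v > 0"
proof (rule ccontr)
  assume "\<not> f v > 0"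
  then have v0: "f v = 0" by simp
  then have u2: "f u = 2" using zero_end_dominated[OF e] by simp
  obtain w where w: "{v, w} \<in> E" "w \<noteq> u"
    using second_neighbour[of v u] e by (auto simp: insert_commute)
  have w0: "f w = 0"
  proof (rule ccontr)
    assume wpos: "f w \<noteq> 0"
    have "TRD_function V (E - {{u, v}}) (f(v := max 1 (f v)))"
    proof (rule TRD_function_raise[OF f])
      fix x assume x: "x \<in> V"
      show "\<exists>y\<in>V. {y, x} \<in> E - {{u, v}} \<and> f y = 2" if h: "f x = 0" "x \<noteq> v"
      proof -
        obtain y where y: "y \<in> V" "{y, x} \<in> E" "f y = 2"
          using f x h by (blast dest: TRD_function_zeroD TRD_function_posD)
        \<comment> \<open>The edge \<open>uv\<close> dominates \<open>v\<close> alone, which is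
          exempt after being raised.\<close>
        moreover have "{y, x} \<noteq> {u, v}"
          using h u2 by (auto simp: doubleton_eq_iff)
        ultimately show ?thesis by auto
      qed
      show "\<exists>y\<in>V. {y, x} \<in> E - {{u, v}} \<and> (f y > 0 \<or> y = v)" if h: "f x > 0 \<or> x = v"
      proof (cases "x = v")
        case True
        then show ?thesis
          using w wpos edgeD[OF w(1)] edgeD[OF e(1)]
          by (intro bexI[of _ w]) (auto simp: insert_commute doubleton_eq_iff)
      next
        case False
        then obtain y where y: "y \<in> V" "{y, x} \<in> E" "f y > 0"
          using f x h by (blast dest: TRD_function_zeroD TRD_function_posD)
        moreover have "{y, x} \<noteq> {u, v}"
          using False y v0 by (auto simp: doubleton_eq_iff)
        ultimately show ?thesis by auto
      qed
    qed
    from removed_weight[OF e this] sum_raise_le[of f v] minimum show False by linarith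
  qed
  then obtain x where x: "{x, w} \<in> E" "f x = 2"
    using f edgeD[OF w(1)] by (blast dest: TRD_function_zeroD TRD_function_posD)
  then have "degree E w \<noteq> 1"
    using degree_one_unique_neighbour[of E w x v] w v0 by (auto simp: insert_commute)
  then have "f w = 2"
    using zero_end_dominated[of w v] w e(3) v0 by (simp add: insert_commute)
  then show False using w0 by simp
qed

text \<open>If \<open>w\<close> were positive, \<open>u\<close> would keep a positive neighbour
  without \<open>v\<close>. Raising a second neighbour \<open>z\<close> of \<open>v\<close> does the
  same for \<open>v\<close>, at cost at most 1, so \<open>uv\<close> could be removed.\<close>

lemma inner_edge_other_neighbour_zero:
  assumes e: "{u, v} \<in> E" "degree E u \<noteq> 1" "degree E v \<noteq> 1"
    and w: "{u, w} \<in> E" "w \<noteq> v"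
  shows "f w = 0"
proof (rule ccontr)
  assume wpos: "f w \<noteq> 0"
  have pos: "f u > 0" "f v > 0"
    using inner_edge_end_positive[of u v] inner_edge_end_positive[of v u] e
    by (auto simp: insert_commute)
  obtain z where z: "{v, z} \<in> E" "z \<noteq> u"
    using second_neighbour[of v u] e by (auto simp: insert_commute)
  have "TRD_function V (E - {{u, v}}) (f(z := max 1 (f z)))"
  proof (rule TRD_function_raise[OF f])
    fix x assume x: "x \<in> V"
    show "\<exists>y\<in>V. {y, x} \<in> E - {{u, v}} \<and> f y = 2" if h: "f x = 0" "x \<noteq> z"
    proof -
      obtain y where y: "y \<in> V" "{y, x} \<in> E" "f y = 2"
        using f x h by (blast dest: TRD_function_zeroD TRD_function_posD)
      \<comment> \<open>Both ends of \<open>uv\<close> are positive, so it dominates no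
        zero.\<close>
      moreover have "{y, x} \<noteq> {u, v}"
        using h pos by (auto simp: doubleton_eq_iff)
      ultimately show ?thesis by auto
    qed
    show "\<exists>y\<in>V. {y, x} \<in> E - {{u, v}} \<and> (f y > 0 \<or> y = z)" if h: "f x > 0 \<or> x = z"
    proof -
      consider "x = u" | "x = v" | "x = z" | "x \<noteq> u" "x \<noteq> v" "x \<noteq> z" by blast
      then show ?thesis
      proof cases
        case 1
        then show ?thesis
          using w wpos edgeD[OF w(1)] edgeD[OF e(1)]
          by (intro bexI[of _ w]) (auto simp: insert_commute doubleton_eq_iff)
      next
        case 2
        then show ?thesis
          using z edgeD[OF z(1)] edgeD[OF e(1)]
          by (intro bexI[of _ z]) (auto simp: insert_commute doubleton_eq_iff)
      next
        case 3
        then show ?thesis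
          using z pos edgeD[OF z(1)] edgeD[OF e(1)]
          by (intro bexI[of _ v]) (auto simp: insert_commute doubleton_eq_iff)
      next
        case 4
        then obtain y where y: "y \<in> V" "{y, x} \<in> E" "f y > 0"
          using f x h by (blast dest: TRD_function_zeroD TRD_function_posD)
        moreover have "{y, x} \<noteq> {u, v}"
          using 4 by (auto simp: doubleton_eq_iff)
        ultimately show ?thesis by auto
      qed
    qed
  qed
  from removed_weight[OF e this] sum_raise_le[of f z] minimum show False by linarith
qed

text \<open>Take a neighbour \<open>u\<close> of value 2. If \<open>u\<close> is a leaf, its only
  neighbour is the zero \<open>v\<close>, so it lacks a positive one; if not, and \<open>v\<close>
  is no leaf either, both ends of \<open>uv\<close> must be positive.\<close>

lemma zero_degree_one:
  assumes "v \<in> V" "f v = 0"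
  shows "degree E v = 1"
proof (rule ccontr)
  assume dv: "degree E v \<noteq> 1"
  obtain u where u: "u \<in> V" "{u, v} \<in> E" "f u = 2"
    using f assms by (blast dest: TRD_function_zeroD TRD_function_posD)
  show False
  proof (cases "degree E u = 1")
    case True
    obtain x where "{x, u} \<in> E" "f x > 0"
      using TRD_function_posD[OF f u(1)] u(3) by auto
    with degree_one_unique_neighbour[OF True u(2), of x] assms(2)
    show False by (simp add: insert_commute)
  next
    case False
    with inner_edge_end_positive[OF u(2) _ dv] assms(2) show False by simp
  qed
qed

end

section \<open>The graph around an edge without leaf ends\<close>

text \<open>Any minimum TRD-function vanishes at \<open>w\<close>, and its zeros are leaves.\<close>

lemma inner_edge_other_neighbour_degree:
  assumes "{u, v} \<in> E" "degree E u \<noteq> 1" "degree E v \<noteq> 1" "{u, w} \<in> E" "w \<noteq> v"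
  shows "degree E w = 1"
proof -
  have "isolated_free V E" using supercritical by (simp add: ER_supercritical_def)
  then obtain f where f: "TRD_function V E f" "sum f V = gamma_tR V E"
    by (rule gamma_tR_attained)
  then have "f w = 0" using inner_edge_other_neighbour_zero assms by blast
  then show ?thesis using zero_degree_one f edgeD assms(4) by blast
qed

text \<open>The facts above hold for every minimum TRD-function. If \<open>v\<close> and
  \<open>w\<close> were the only neighbours of \<open>u\<close>, shifting one unit from
  \<open>u\<close> to \<open>w\<close> would give another minimum, one that is positive at
  \<open>w\<close>.\<close>

lemma inner_edge_degree_ge_3:
  assumes e: "{u, v} \<in> E" "degree E u \<noteq> 1" "degree E v \<noteq> 1"
  shows "degree E u \<ge> 3"
proof (rule ccontr)
  assume small: "\<not> degree E u \<ge> 3"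
  have "isolated_free V E" using supercritical by (simp add: ER_supercritical_def)
  then obtain f where f: "TRD_function V E f" "sum f V = gamma_tR V E"
    by (rule gamma_tR_attained)
  obtain w where w: "{u, w} \<in> E" "w \<noteq> v" using second_neighbour[OF e(1,2)] by blast
  have nbrs: "x = v \<or> x = w" if "{u, x} \<in> E" for x
    using degree_ge_3I[OF e(1) w(1) that] w(2) small by auto
  have V: "u \<in> V" "v \<in> V" "w \<in> V" "u \<noteq> v" "u \<noteq> w"
    using edgeD[OF e(1)] edgeD[OF w(1)] by auto
  have w0: "f w = 0" using inner_edge_other_neighbour_zero[OF f e w] .
  have vpos: "f v > 0" using inner_edge_end_positive[OF f e] .
  obtain x where x: "{x, w} \<in> E" "f x = 2"
    using f(1) V w0 by (blast dest: TRD_function_zeroD TRD_function_posD)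
  \<comment> \<open>\<open>w\<close> is a leaf, so only \<open>u\<close> can dominate it.\<close>
  have "x = u"
    using degree_one_unique_neighbour[OF inner_edge_other_neighbour_degree[OF e w], of x u]
      x(1) w(1) by (simp add: insert_commute)
  then have u2: "f u = 2" using x(2) by simp
  let ?g = "f(u := 1, w := 1)"
  have "TRD_function V E ?g"
    unfolding TRD_function_iff
  proof (intro conjI ballI impI)
    fix y assume y: "y \<in> V"
    show "?g y \<in> {0, 1, 2}" using f(1) y by (auto simp: TRD_function_iff)
    show "\<exists>z\<in>V. {z, y} \<in> E \<and> ?g z = 2" if g0: "?g y = 0"
    proof -
      have y': "y \<noteq> u" "y \<noteq> w" "f y = 0" using g0 by (auto split: if_splits)
      obtain z where z: "z \<in> V" "{z, y} \<in> E" "f z = 2"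
        using f(1) y y'(3) by (blast dest: TRD_function_zeroD TRD_function_posD)
      \<comment> \<open>Lowering \<open>u\<close> harms no zero: its neighbours \<open>v\<close> and
        \<open>w\<close> are both positive under \<open>?g\<close>.\<close>
      have "z \<noteq> u" using nbrs[of y] z(2) y' vpos by auto
      moreover have "z \<noteq> w" using z(3) w0 by auto
      ultimately show ?thesis using z by auto
    qed
    show "\<exists>z\<in>V. {z, y} \<in> E \<and> ?g z > 0" if g1: "?g y > 0"
    proof (cases "y = w")
      case True
      then show ?thesis using V w by auto
    next
      case False
      then have "f y > 0" using g1 u2 by (auto split: if_splits)
      then obtain z where "z \<in> V" "{z, y} \<in> E" "f z > 0"
        using f(1) y by (blast dest: TRD_function_zeroD TRD_function_posD)
      then show ?thesis by (intro bexI[of _ z]) auto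
    qed
  qed
  moreover have "sum ?g V = sum f V"
    using finite_V V u2 w0
    by (simp add: sum.remove[where x = u] sum.remove[where x = w and A = "V - {u}"])
  ultimately have "?g w = 0"
    using inner_edge_other_neighbour_zero[of ?g, OF _ _ e w] f(2) by simp
  then show False by simp
qed

text \<open>All neighbours of \<open>u\<close> and \<open>v\<close> apart from these two are leaves,
  so together they form a set closed under adjacency, which by connectedness is all of
  \<open>V\<close>.\<close>

lemma double_star_if_inner_edge:
  assumes conn: "connected_graph V E"
    and e: "{u, v} \<in> E" "degree E u \<noteq> 1" "degree E v \<noteq> 1"
  shows "double_star V E \<and> (\<forall>x\<in>V. degree E x \<noteq> 1 \<longrightarrow> degree E x \<ge> 3)"
proof -
  have e': "{v, u} \<in> E" using e(1) by (simp add: insert_commute)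
  define A where "A = {x. {u, x} \<in> E \<and> x \<noteq> v}"
  define B where "B = {x. {v, x} \<in> E \<and> x \<noteq> u}"
  have leafA: "degree E x = 1" if "x \<in> A" for x
    using that inner_edge_other_neighbour_degree[OF e] by (auto simp: A_def)
  have leafB: "degree E x = 1" if "x \<in> B" for x
    using that inner_edge_other_neighbour_degree[OF e' e(3,2)] by (auto simp: B_def)
  have onlyA: "y = u" if "x \<in> A" "{x, y} \<in> E" for x y
    using degree_one_unique_neighbour[OF leafA[OF that(1)] that(2), of u] that(1)
    by (auto simp: A_def insert_commute)
  have onlyB: "y = v" if "x \<in> B" "{x, y} \<in> E" for x y
    using degree_one_unique_neighbour[OF leafB[OF that(1)] that(2), of v] that(1)
    by (auto simp: B_def insert_commute)
  have uv: "u \<noteq> v" "u \<in> V" "v \<in> V" using edgeD[OF e(1)] by auto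
  have AB: "A \<inter> B = {}" "u \<notin> A" "u \<notin> B" "v \<notin> A" "v \<notin> B" "A \<subseteq> V" "B \<subseteq> V"
  proof -
    \<comment> \<open>A common neighbour would be a leaf attached to \<open>u\<close> yet adjacent
      to \<open>v\<close>.\<close>
    show "A \<inter> B = {}"
      using onlyA[of _ v] uv(1) by (auto simp: B_def insert_commute)
    show "u \<notin> A" "v \<notin> B" using edgeD(3)[of u u] edgeD(3)[of v v] unfolding A_def B_def by blast+
    show "A \<subseteq> V" "B \<subseteq> V" using edgeD(2) unfolding A_def B_def by blast+
  qed (simp_all add: A_def B_def)
  have VAB: "V = insert u A \<union> insert v B"
  proof
    show "V \<subseteq> insert u A \<union> insert v B"
    proof (rule connected_closed_subset[OF conn])
      fix x y assume "x \<in> insert u A \<union> insert v B" "{x, y} \<in> E"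
      then show "y \<in> insert u A \<union> insert v B"
        using onlyA onlyB unfolding A_def B_def by blast
    qed (use uv in auto)
  qed (use uv AB in auto)
  have EAB: "E = {{u, x} |x. x \<in> A} \<union> {{v, x} |x. x \<in> B} \<union> {{u, v}}" (is "E = ?R")
  proof
    show "E \<subseteq> ?R"
    proof
      fix d assume d: "d \<in> E"
      then obtain x y where xy: "d = {x, y}" by (rule edge_pairE)
      then have *: "{x, y} \<in> E" "{y, x} \<in> E" using d by (auto simp: insert_commute)
      then have "x \<in> V" using edgeD by blast
      then consider "x = u" | "x = v" | "x \<in> A" | "x \<in> B" using VAB by auto
      then show "d \<in> ?R"
      proof cases
        case 1 then show ?thesis using * xy by (auto simp: A_def)
      next
        case 2 then show ?thesis using * xy by (auto simp: B_def insert_commute)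
      next
        case 3
        then have "y = u" using onlyA *(1) by blast
        then show ?thesis using 3 xy by (auto simp: insert_commute)
      next
        case 4
        then have "y = v" using onlyB *(1) by blast
        then show ?thesis using 4 xy by (auto simp: insert_commute)
      qed
    qed
    show "?R \<subseteq> E" using e by (auto simp: A_def B_def)
  qed
  have fin: "finite A" "finite B" using AB(6,7) finite_V finite_subset by blast+
  \<comment> \<open>Since \<open>u\<close> and \<open>v\<close> are not leaves, both stars are
    non-trivial.\<close>
  have "A \<noteq> {}" using second_neighbour[OF e(1,2)] by (auto simp: A_def)
  moreover have "B \<noteq> {}" using second_neighbour[OF e' e(3)] by (auto simp: B_def)
  ultimately have n: "card A \<ge> 1" "card B \<ge> 1"
    using fin by (auto simp: Suc_le_eq card_gt_0_iff)
  have st: "star_centred u (card A) (insert u A) {{u, x} |x. x \<in> A}"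
    "star_centred v (card B) (insert v B) {{v, x} |x. x \<in> B}"
    using fin AB by (simp_all add: star_centred_def)
  have disj: "insert u A \<inter> insert v B = {}" using AB uv by auto
  have "double_star V E"
    unfolding double_star_def
    by (intro exI conjI) (rule n(1) st(1) n(2) st(2) disj VAB EAB)+
  moreover have "degree E x \<ge> 3" if "x \<in> V" "degree E x \<noteq> 1" for x
  proof -
    have "x = u \<or> x = v" using that leafA leafB unfolding VAB by blast
    then show ?thesis
      using inner_edge_degree_ge_3[OF e] inner_edge_degree_ge_3[OF e' e(3,2)] by blast
  qed
  ultimately show ?thesis by blast
qed

end

section \<open>Stars as the graphs with only pendant edges\<close>

text \<open>The centre is the neighbour \<open>c\<close> of some leaf \<open>l\<close>: all
  neighbours of \<open>c\<close> are leaves, so connectedness leaves no further vertices.\<close>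

lemma (in fin_simple_graph) star_if_no_inner_edge:
  assumes conn: "connected_graph V E" and iso: "isolated_free V E"
    and pendant: "\<And>u v. {u, v} \<in> E \<Longrightarrow> degree E u = 1 \<or> degree E v = 1"
  shows "\<exists>n\<ge>1. is_star n V E"
proof -
  obtain a where "a \<in> V" using conn by (auto simp: connected_graph_def)
  then obtain b where "{b, a} \<in> E" using iso by (auto simp: isolated_free_def)
  then obtain c l where cl: "{c, l} \<in> E" "degree E l = 1"
    using pendant[of b a] by (metis insert_commute)
  \<comment> \<open>If it is \<open>c\<close> that has degree 1, then \<open>x\<close> is the leaf
    \<open>l\<close>.\<close>
  have leaf: "degree E x = 1" if "{c, x} \<in> E" for x
    using pendant[OF that] degree_one_unique_neighbour[OF _ that cl(1)] cl(2) by auto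
  have only: "y = c" if "{c, x} \<in> E" "{x, y} \<in> E" for x y
    using degree_one_unique_neighbour[OF leaf[OF that(1)] that(2), of c] that(1)
    by (simp add: insert_commute)
  have c: "c \<in> V" "l \<in> V" "c \<noteq> l" using edgeD[OF cl(1)] by auto
  have "V \<subseteq> insert c {x. {c, x} \<in> E}"
    by (rule connected_closed_subset[OF conn]) (use c only in auto)
  then have nb: "{c, x} \<in> E" if "x \<in> V - {c}" for x using that by auto
  have "E = {{c, x} |x. x \<in> V - {c}}" (is "E = ?R")
  proof
    show "E \<subseteq> ?R"
    proof
      fix d assume d: "d \<in> E"
      then obtain x y where xy: "d = {x, y}" by (rule edge_pairE)
      then have *: "{x, y} \<in> E" using d by simp
      show "d \<in> ?R"
      proof (cases "x = c")
        case True then show ?thesis using edgeD[OF *] xy by auto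
      next
        case False
        then have "y = c" using only[OF nb *] edgeD[OF *] by auto
        then show ?thesis using edgeD[OF *] xy by (auto simp: insert_commute)
      qed
    qed
    show "?R \<subseteq> E" using nb by auto
  qed
  then have "is_star (card (V - {c})) V E"
    using finite_V c by (auto simp: is_star_def star_centred_def)
  moreover have "card (V - {c}) \<noteq> 0"
    using finite_V c by (subst card_0_eq) auto
  then have "card (V - {c}) \<ge> 1" by linarith
  ultimately show ?thesis by blast
qed

text \<open>Every edge of a star has a leaf end, so every removal has value \<infinity>.\<close>

lemma (in fin_simple_graph) star_ER_supercritical:
  assumes "isolated_free V E" "is_star n V E"
  shows "ER_supercritical V E"
proof -
  obtain c where E: "E = {{c, x} |x. x \<in> V - {c}}"
    using assms(2) by (auto simp: is_star_def star_centred_def)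
  have "\<exists>v\<in>d. degree E v = 1" if d: "d \<in> E" for d
  proof -
    obtain x where x: "d = {c, x}" "x \<in> V - {c}" using d E by auto
    have "degree E x = 1"
    proof (rule degree_one_if_unique)
      show "{x, c} \<in> E" using x d by (simp add: insert_commute)
      show "y = c" if "{x, y} \<in> E" for y
        using that x E by (auto simp: doubleton_eq_iff)
    qed
    then show ?thesis using x by auto
  qed
  then show ?thesis using assms(1) by (auto simp: ER_supercritical_def gamma_tR_remove_def)
qed

section \<open>Double stars with large centres are supercritical\<close>

text \<open>The hypotheses say that \<open>c\<close> and \<open>A\<close> form a star component of
  \<open>F\<close>, so the bound applies to each half of a split double star. The centre is
  positive, since a leaf dominating it would lack a positive neighbour. Either it has value 2 and
  some leaf is positive, or it has value 1 and all leaves are positive.\<close>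

lemma TRD_function_star_weight:
  assumes f: "TRD_function V F f"
    and S: "finite A" "c \<notin> A" "insert c A \<subseteq> V" "card A \<ge> 2"
    and centre: "\<And>y. {y, c} \<in> F \<Longrightarrow> y \<in> A"
    and leaf: "\<And>x y. x \<in> A \<Longrightarrow> {y, x} \<in> F \<Longrightarrow> y = c"
  shows "sum f (insert c A) \<ge> 3"
proof -
  have cpos: "f c > 0"
  proof (rule ccontr)
    assume "\<not> f c > 0"
    then have c0: "f c = 0" by simp
    then obtain y where y: "y \<in> V" "{y, c} \<in> F" "f y = 2"
      using f S(3) by (blast dest: TRD_function_zeroD TRD_function_posD)
    then obtain z where "{z, y} \<in> F" "f z > 0"
      using f by (fastforce dest: TRD_function_zeroD TRD_function_posD)
    with leaf[OF centre[OF y(2)]] c0 show False by auto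
  qed
  have le: "sum f B \<le> sum f A" if "B \<subseteq> A" for B
    using that S(1) by (intro sum_mono2) auto
  have sum: "sum f (insert c A) = f c + sum f A" using S by simp
  show ?thesis
  proof (cases "f c = 2")
    case True
    obtain y where y: "{y, c} \<in> F" "f y > 0"
      using f S(3) cpos by (blast dest: TRD_function_zeroD TRD_function_posD)
    then have "f y \<le> sum f A" using centre le[of "{y}"] by simp
    then show ?thesis using sum True y by simp
  next
    case False
    have "f x \<ge> 1" if "x \<in> A" for x
    proof (rule ccontr)
      assume "\<not> f x \<ge> 1"
      then obtain y where "{y, x} \<in> F" "f y = 2"
        using f S(3) \<open>x \<in> A\<close> by (fastforce dest: TRD_function_zeroD TRD_function_posD)
      then show False using leaf \<open>x \<in> A\<close> False by blast
    qed
    \<comment> \<open>Two leaves matter here: with one, the weight could be 1 + 1 = 2.\<close>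
    then have "card A \<le> sum f A" using sum_mono[of A "\<lambda>_. 1" f] by simp
    then show ?thesis using sum cpos S(4) by simp
  qed
qed

text \<open>Only the central edge has a finite removal value. The double star has weight at most 4,
  while the two stars left by the removal need at least 3 each.\<close>

lemma (in fin_simple_graph) double_star_ER_supercritical:
  assumes iso: "isolated_free V E" and ds: "double_star V E"
    and deg: "\<forall>v\<in>V. degree E v \<noteq> 1 \<longrightarrow> degree E v \<ge> 3"
  shows "ER_supercritical V E"
proof -
  obtain a m V1 E1 b n V2 E2 where
    "m \<ge> 1" "star_centred a m V1 E1" "n \<ge> 1" "star_centred b n V2 E2"
    "V1 \<inter> V2 = {}" "V = V1 \<union> V2" "E = E1 \<union> E2 \<union> {{a, b}}"
    using ds unfolding double_star_def by blast
  note ds = this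
  define A where "A = V1 - {a}"
  define B where "B = V2 - {b}"
  have V12: "V1 = insert a A" "V2 = insert b B"
    using ds(2,4) by (auto simp: A_def B_def star_centred_def)
  have fin: "finite A" "finite B" and card: "card A \<ge> 1" "card B \<ge> 1"
    using ds(1-4) by (auto simp: A_def B_def star_centred_def)
  have "a \<notin> A" "b \<notin> B" by (simp_all add: A_def B_def)
  moreover have "a \<notin> B" "b \<notin> A" "a \<noteq> b" "A \<inter> B = {}"
    using ds(5) unfolding V12 by auto
  ultimately have dist: "a \<notin> A" "b \<notin> B" "a \<notin> B" "b \<notin> A" "a \<noteq> b" "A \<inter> B = {}" .
  have V: "V = insert a A \<union> insert b B" using ds(6) V12 by simp
  have F: "E = {{a, x} |x. x \<in> A} \<union> {{b, x} |x. x \<in> B} \<union> {{a, b}}"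
    using ds(2,4,7) by (simp add: A_def B_def star_centred_def)
  have leafA: "degree E x = 1" if "x \<in> A" for x
    by (rule degree_one_if_unique[of x a])
      (use that dist F in \<open>auto simp: doubleton_eq_iff\<close>)
  have leafB: "degree E x = 1" if "x \<in> B" for x
    by (rule degree_one_if_unique[of x b])
      (use that dist F in \<open>auto simp: doubleton_eq_iff\<close>)
  have "gamma_tR_remove V E d \<ge> enat (gamma_tR V E) + 2" if "d \<in> E" for d
  proof (cases "\<exists>v\<in>d. degree E v = 1")
    case True
    then show ?thesis by (simp add: gamma_tR_remove_def)
  next
    case False
    then have d: "d = {a, b}" using that F leafA leafB by auto
    let ?F = "E - {{a, b}}"
    have F': "?F = {{a, x} |x. x \<in> A} \<union> {{b, x} |x. x \<in> B}"
      using F dist by (auto simp: doubleton_eq_iff)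
    have "degree E a \<ge> 3" "degree E b \<ge> 3" using False d deg V by auto
    \<comment> \<open>One of the at least three edges at each centre is \<open>ab\<close>, which
      leaves at least two leaves per centre.\<close>
    moreover have "degree E a \<le> card (insert {a, b} ((\<lambda>x. {a, x}) ` A))"
      unfolding degree_def by (rule card_mono) (use fin F dist in auto)
    moreover have "degree E b \<le> card (insert {a, b} ((\<lambda>x. {b, x}) ` B))"
      unfolding degree_def by (rule card_mono) (use fin F dist in auto)
    moreover have "card (insert {a, b} ((\<lambda>x. {a, x}) ` A)) \<le> card A + 1"
      "card (insert {a, b} ((\<lambda>x. {b, x}) ` B)) \<le> card B + 1"
      using fin card_image_le[of A "\<lambda>x. {a, x}"] card_image_le[of B "\<lambda>x. {b, x}"]
      by (simp_all add: card_insert_if)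
    ultimately have card2: "card A \<ge> 2" "card B \<ge> 2" by linarith+

    \<comment> \<open>Each centre dominates its leaves and is the positive neighbour of the
      other.\<close>
    let ?g = "\<lambda>x. if x = a \<or> x = b then 2 else 0 :: nat"
    have "TRD_function V E ?g"
      using V F by (auto simp: TRD_function_iff insert_commute)
    then have "gamma_tR V E \<le> sum ?g V" by (rule gamma_tR_le)
    also have "sum ?g V = sum ?g {a, b}"
      using finite_V V by (intro sum.mono_neutral_right) auto
    finally have up: "gamma_tR V E \<le> 4" using dist by simp

    \<comment> \<open>Needed for the minimum after the removal to be attained.\<close>
    have "\<exists>y\<in>V. {y, x} \<in> ?F" if "x \<in> V" for x
    proof -
      obtain p q where pq: "p \<in> A" "q \<in> B" using card by fastforce
      have edges: "{y, a} \<in> ?F" "{a, y} \<in> ?F" if "y \<in> A" for y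
        unfolding F' using that by (auto simp: insert_commute)
      have edges': "{y, b} \<in> ?F" "{b, y} \<in> ?F" if "y \<in> B" for y
        unfolding F' using that by (auto simp: insert_commute)
      consider "x = a" | "x = b" | "x \<in> A" | "x \<in> B" using \<open>x \<in> V\<close> V by auto
      then show ?thesis
      proof cases
        case 1 show ?thesis using edges(1)[OF pq(1)] pq(1) V 1 by (intro bexI[of _ p]) simp_all
      next
        case 2 show ?thesis using edges'(1)[OF pq(2)] pq(2) V 2 by (intro bexI[of _ q]) simp_all
      next
        case 3 show ?thesis using edges(2)[OF 3] V by (intro bexI[of _ a]) simp_all
      next
        case 4 show ?thesis using edges'(2)[OF 4] V by (intro bexI[of _ b]) simp_all
      qed
    qed
    then have "isolated_free V ?F" by (auto simp: isolated_free_def)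
    then obtain f where f: "TRD_function V ?F f" "sum f V = gamma_tR V ?F"
      by (rule gamma_tR_attained)
    have "sum f (insert a A) \<ge> 3"
      by (rule TRD_function_star_weight[OF f(1)])
        (use fin dist V card2 F' in \<open>auto simp: doubleton_eq_iff\<close>)
    moreover have "sum f (insert b B) \<ge> 3"
      by (rule TRD_function_star_weight[OF f(1)])
        (use fin dist V card2 F' in \<open>auto simp: doubleton_eq_iff\<close>)
    moreover have "sum f V = sum f (insert a A) + sum f (insert b B)"
      unfolding V by (rule sum.union_disjoint) (use fin dist in auto)
    ultimately have "gamma_tR V E + 2 \<le> gamma_tR V ?F" using f(2) up by linarith
    then show ?thesis using False d by (simp add: gamma_tR_remove_def numeral_eq_enat)
  qed
  then show ?thesis using iso by (simp add: ER_supercritical_def)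
qed

theorem theorem8p1:
  fixes V :: "'a set" and E :: "'a set set"
  assumes "simple_graph V E" and "connected_graph V E" and "isolated_free V E"
  shows "ER_supercritical V E \<longleftrightarrow>
    (\<exists>n\<ge>1. is_star n V E) \<or>
    (double_star V E \<and> (\<forall>v\<in>V. degree E v \<noteq> 1 \<longrightarrow> degree E v \<ge> 3))"
proof
  interpret fin_simple_graph V E by unfold_locales (rule assms(1))
  assume "ER_supercritical V E"
  then interpret supercritical_graph V E by unfold_locales
  \<comment> \<open>The cases are whether or not some edge has no end of degree 1.\<close>
  show "(\<exists>n\<ge>1. is_star n V E) \<or>
    (double_star V E \<and> (\<forall>v\<in>V. degree E v \<noteq> 1 \<longrightarrow> degree E v \<ge> 3))"
    using star_if_no_inner_edge[OF assms(2,3)] double_star_if_inner_edge[OF assms(2)] by blast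
next
  interpret fin_simple_graph V E by unfold_locales (rule assms(1))
  assume "(\<exists>n\<ge>1. is_star n V E) \<or>
    (double_star V E \<and> (\<forall>v\<in>V. degree E v \<noteq> 1 \<longrightarrow> degree E v \<ge> 3))"
  then show "ER_supercritical V E"
    using star_ER_supercritical[OF assms(3)] double_star_ER_supercritical[OF assms(3)] by blast
qed

end
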